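(* Let $L_E$ be a real random variable with density $f_{L_E}(u)=\operatorname{sech}(\pi u)$, $u\in\mathbb{R}$. For every $x\in\mathbb{R}$, $$\log\mathfrak{E}(x):=E\log\left(x-\tfrac12+\imath L_E\right)=\log\left(2\,\frac{\Gamma^2\left(\frac34+\frac12\left|x-\frac12\right|\right)}{\Gamma^2\left(\frac14+\frac12\left|x-\frac12\right|\right)}\right).$$
   Context: $\imath$ is the imaginary unit, $\log$ is the principal branch of the complex logarithm, and $\Gamma$ is the Euler gamma function. $E$ denotes expectation: $E\,g(L_E)=\int_{\mathbb{R}}g(u)\operatorname{sech}(\pi u)\,du$. For non-polynomial $h$ the nonlinear function $h(\mathfrak{E}(x))$ of the Euler umbra is understood as $E\,h(x-\frac12+\imath L_E)$. *)

theory Defs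
  imports "HOL-Probability.Probability"
begin

definition sech :: "real \<Rightarrow> real" where
  "sech u = 1 / cosh u"

text \<open>
  The nonlinear function \<open>h(E(x))\<close> of the Euler umbra, that is, the expectation
  of \<open>h(x - 1/2 + \<i> L)\<close> for a random variable \<open>L\<close> on \<open>M\<close>. The Bochner integral is 0 when
  the integrand is not integrable, so statements about this value should be accompanied
  by integrability.
\<close>

definition euler_umbra_arg :: "('a \<Rightarrow> real) \<Rightarrow> real \<Rightarrow> 'a \<Rightarrow> complex" where
  "euler_umbra_arg L x \<omega> = complex_of_real (x - 1/2) + \<i> * complex_of_real (L \<omega>)"

definition euler_umbra_fun ::
    "'a measure \<Rightarrow> ('a \<Rightarrow> real) \<Rightarrow> (complex \<Rightarrow> complex) \<Rightarrow> real \<Rightarrow> complex" where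
  "euler_umbra_fun M L h x = prob_space.expectation M (\<lambda>\<omega>. h (euler_umbra_arg L x \<omega>))"

end

theory Submission
  imports Defs "HOL-Real_Asymp.Real_Asymp"
begin

text \<open>
  Put \<open>a = \<bar>x - 1/2\<bar>\<close> and \<open>\<psi> = Digamma\<close>. The argument of \<open>x - 1/2 + \<i> u\<close> is an odd function of
  \<open>u \<noteq> 0\<close> and \<open>sech (\<pi> u)\<close> is even, so the imaginary part of the expectation vanishes. What remains is
  the real identity \<open>I(a) = G(a) + ln 2\<close>, where
  \<open>I(a) = \<integral> sech (\<pi> u) ln (a\<^sup>2 + u\<^sup>2) / 2 du\<close> and \<open>G(a) = 2 (ln \<Gamma>(3/4 + a/2) - ln \<Gamma>(1/4 + a/2))\<close>.

  The increments of \<open>I\<close> and \<open>G\<close> agree. Since \<open>ln (b\<^sup>2 + u\<^sup>2) / 2 - ln (a\<^sup>2 + u\<^sup>2) / 2\<close> is the integral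
  of the nonnegative function \<open>t / (t\<^sup>2 + u\<^sup>2)\<close> over \<open>t \<in> [a, b]\<close>, Tonelli's theorem reduces this to
  \<open>\<integral> sech (\<pi> u) t / (t\<^sup>2 + u\<^sup>2) du = \<psi>(3/4 + t/2) - \<psi>(1/4 + t/2)\<close> for \<open>t > 0\<close>
  (\<open>has_bochner_integral_sech_cauchy_kernel\<close>). For the latter, the reflection formula for \<open>\<psi>\<close> yields the
  partial fraction expansion of \<open>\<pi> sech (\<pi> u)\<close> into kernels \<open>c / (c\<^sup>2 + u\<^sup>2)\<close>
  (\<open>sech_partial_fractions\<close>). Grouped in consecutive pairs it converges uniformly in \<open>u\<close>, so it may be
  integrated termwise using \<open>\<integral> t / (t\<^sup>2 + u\<^sup>2) \<sqdot> c / (c\<^sup>2 + u\<^sup>2) du = \<pi> / (t + c)\<close>, and the result is the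
  series of the Digamma difference.

  Hence \<open>I - G\<close> is constant on \<open>[0, \<infinity>)\<close>. The constant is \<open>ln 2\<close> because, as \<open>a\<close> tends to infinity,
  both \<open>I(a) - ln a\<close> and \<open>G(a) + ln 2 - ln a\<close> tend to 0, the first because \<open>sech (\<pi> u)\<close> has a finite
  second moment and the second by logarithmic convexity of \<open>\<Gamma>\<close> (\<open>Gamma_half_shift_bounds\<close>).
  The same increments, started from \<open>a = 1\<close>, give the integrability down to \<open>a = 0\<close>.
\<close>

section \<open>Partial fractions of the hyperbolic secant\<close>

text \<open>
  Logarithmic differentiation of \<open>\<Gamma>(z) \<Gamma>(1 - z) = \<pi> / sin (\<pi> z)\<close>. The form
  multiplied by the sine avoids a division.
\<close>

lemma Digamma_reflection_complex:
  fixes z :: complex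
  shows "z \<notin> \<int> \<Longrightarrow> (Digamma (1 - z) - Digamma z) * sin (of_real pi * z) = of_real pi * cos (of_real pi * z)"
proof -
  assume z: "z \<notin> \<int>"
  have z': "z \<notin> \<int>\<^sub>\<le>\<^sub>0" "1 - z \<notin> \<int>\<^sub>\<le>\<^sub>0"
    using z nonpos_Ints_Int[of z] nonpos_Ints_Int[of "1 - z"] Ints_diff[of 1 "1 - z"] by auto
  have eq: "(\<lambda>w. rGamma w * rGamma (1 - w)) = (\<lambda>w::complex. sin (of_real pi * w) / of_real pi)"
    using rGamma_reflection_complex by auto
  have D1: "((\<lambda>w. rGamma w * rGamma (1 - w)) has_field_derivative
        (rGamma z * rGamma (1 - z)) * (Digamma (1 - z) - Digamma z)) (at z)"
    using z' by (auto intro!: derivative_eq_intros simp: algebra_simps)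
  have D2: "((\<lambda>w::complex. sin (of_real pi * w) / of_real pi) has_field_derivative
        cos (of_real pi * z)) (at z)"
    by (auto intro!: derivative_eq_intros)
  have "(rGamma z * rGamma (1 - z)) * (Digamma (1 - z) - Digamma z) = cos (of_real pi * z)"
    using DERIV_unique[OF D1] D2 eq by metis
  then show ?thesis
    by (simp add: rGamma_reflection_complex field_simps)
qed

text \<open>
  The Cauchy (Poisson) kernel of scale \<open>c\<close>, normalised to have total mass \<open>\<pi>\<close> for \<open>c > 0\<close>.
\<close>

definition cauchy_kernel :: "real \<Rightarrow> real \<Rightarrow> real" where
  "cauchy_kernel c u = c / (c\<^sup>2 + u\<^sup>2)"

lemma cauchy_kernel_nonneg: "c \<ge> 0 \<Longrightarrow> cauchy_kernel c u \<ge> 0"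
  by (simp add: cauchy_kernel_def)

lemma borel_measurable_cauchy_kernel [measurable]:
  "(\<lambda>(c, u). cauchy_kernel c u) \<in> borel_measurable (borel \<Otimes>\<^sub>M borel)"
  "cauchy_kernel c \<in> borel_measurable borel"
  unfolding cauchy_kernel_def by measurable

text \<open>
  The reflection formula at \<open>z = 1/4 + \<i> u/2\<close>: the real part of \<open>cot (\<pi> z)\<close> is \<open>sech (\<pi> u)\<close>.
\<close>

lemma sech_eq_Re_Digamma:
  "pi * sech (pi * u) =
     Re (Digamma (3/4 - \<i> * of_real (u/2)) - Digamma (1/4 + \<i> * of_real (u/2)))"
proof -
  define z where "z = 1/4 + \<i> * complex_of_real (u/2)"
  define d where "d = Digamma (1 - z) - Digamma z"
  define C S where "C = cosh (pi * u / 2)" and "S = sinh (pi * u / 2)"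
  have "z \<notin> \<int>"
  proof
    assume "z \<in> \<int>"
    then obtain n where "z = of_int n" by (auto elim: Ints_cases)
    then have "Re z = of_int n" by simp
    then have "4 * real_of_int n = 1" by (simp add: z_def)
    then have "4 * n = 1" by linarith
    then show False by presburger
  qed
  then have "d * sin (of_real pi * z) = of_real pi * cos (of_real pi * z)"
    unfolding d_def by (rule Digamma_reflection_complex)
  moreover have piz: "of_real pi * z = Complex (pi / 4) (pi * u / 2)"
    by (simp add: complex_eq_iff z_def)
  have "sin (of_real pi * z) = of_real (sqrt 2 / 2) * Complex C S"
    unfolding piz complex_eq_iff Re_sin Im_sin
    by (simp add: C_def S_def cosh_def sinh_def sin_45 cos_45)
  moreover have "cos (of_real pi * z) = of_real (sqrt 2 / 2) * Complex C (- S)"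
    unfolding piz complex_eq_iff Re_cos Im_cos
    by (simp add: C_def S_def cosh_def sinh_def sin_45 cos_45 minus_mult_right[symmetric] right_diff_distrib)
  ultimately have "of_real (sqrt 2 / 2) * (d * Complex C S) =
      of_real (sqrt 2 / 2) * (of_real pi * Complex C (- S))"
    by (metis mult.left_commute)
  then have "d * Complex C S = of_real pi * Complex C (- S)"
    by simp
  moreover have "Complex C S \<noteq> 0"
    by (simp add: complex_eq_iff C_def)
  ultimately have "d = of_real pi * Complex C (- S) / Complex C S"
    by (simp add: field_simps)
  then have "Re d = pi * (C\<^sup>2 - S\<^sup>2) / (C\<^sup>2 + S\<^sup>2)"
    by (simp add: Re_divide power2_eq_square algebra_simps diff_divide_distrib)
  also have "C\<^sup>2 - S\<^sup>2 = 1"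
    by (simp add: C_def S_def cosh_square_eq)
  also have "C\<^sup>2 + S\<^sup>2 = cosh (pi * u)"
    using cosh_double[of "pi * u / 2"] by (simp add: C_def S_def)
  finally show ?thesis
    by (simp add: d_def z_def sech_def)
qed

lemma sech_partial_fractions:
  "(\<lambda>k. 2 * (cauchy_kernel (2 * real k + 1/2) u - cauchy_kernel (2 * real k + 3/2) u))
     sums (pi * sech (pi * u))"
proof -
  define z where "z = 1/4 + \<i> * complex_of_real (u/2)"
  have Dig: "(\<lambda>k. inverse (of_nat (Suc k)) - inverse (w + of_nat k)) sums
      (Digamma w + euler_mascheroni)" if "w \<noteq> 0" for w :: complex
    using summable_Digamma[OF that] by (simp add: Digamma_def summable_sums)
  have nz: "z \<noteq> 0" "1 - z \<noteq> 0"
    by (auto simp: z_def complex_eq_iff)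
  have "(\<lambda>k. inverse (z + of_nat k) - inverse (1 - z + of_nat k)) sums
      (Digamma (1 - z) - Digamma z)"
    using sums_diff[OF Dig[OF nz(2)] Dig[OF nz(1)]] by simp
  then have "(\<lambda>k. Re (inverse (z + of_nat k) - inverse (1 - z + of_nat k))) sums
      Re (Digamma (1 - z) - Digamma z)"
    by (rule sums_Re)
  also have "Re (Digamma (1 - z) - Digamma z) = pi * sech (pi * u)"
    by (simp add: sech_eq_Re_Digamma z_def)
  also have "(\<lambda>k. Re (inverse (z + of_nat k) - inverse (1 - z + of_nat k))) =
      (\<lambda>k. 2 * (cauchy_kernel (2 * real k + 1/2) u - cauchy_kernel (2 * real k + 3/2) u))"
  proof
    fix k
    have *: "c / 2 / ((c/2)\<^sup>2 + (u/2)\<^sup>2) = 2 * cauchy_kernel c u" for c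
      by (simp add: cauchy_kernel_def power_divide add_divide_distrib[symmetric])
    show "Re (inverse (z + of_nat k) - inverse (1 - z + of_nat k)) =
      2 * (cauchy_kernel (2 * real k + 1/2) u - cauchy_kernel (2 * real k + 3/2) u)"
      using *[of "2 * real k + 1/2"] *[of "2 * real k + 3/2"]
      by (simp add: z_def add_divide_distrib add.commute)
  qed
  finally show ?thesis .
qed

text \<open>
  Single kernels at \<open>u\<close> are only of order \<open>1/c\<close>; the difference of two neighbouring ones is bounded by
  \<open>1/c\<^sup>2\<close> uniformly in \<open>u\<close>, which makes the paired expansion normally convergent.
\<close>

lemma abs_cauchy_kernel_diff_le:
  assumes "c > 0"
  shows "\<bar>cauchy_kernel c u - cauchy_kernel (c + 1) u\<bar> \<le> 1 / c\<^sup>2"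
proof -
  define A B where "A = c\<^sup>2 + u\<^sup>2" and "B = (c + 1)\<^sup>2 + u\<^sup>2"
  have A: "A \<ge> c\<^sup>2" "A > 0" and B: "B > 0" "B \<ge> c * (c + 1) + u\<^sup>2"
    using assms by (auto simp: A_def B_def power2_eq_square algebra_simps intro!: add_pos_nonneg)
  have "cauchy_kernel c u - cauchy_kernel (c + 1) u = (c * B - (c + 1) * A) / (A * B)"
    using A B by (simp add: cauchy_kernel_def A_def[symmetric] B_def[symmetric] diff_frac_eq)
  also have "c * B - (c + 1) * A = c * (c + 1) - u\<^sup>2"
    by (simp add: A_def B_def power2_eq_square algebra_simps)
  finally have "cauchy_kernel c u - cauchy_kernel (c + 1) u = (c * (c + 1) - u\<^sup>2) / (A * B)" .
  then have "\<bar>cauchy_kernel c u - cauchy_kernel (c + 1) u\<bar> = \<bar>c * (c + 1) - u\<^sup>2\<bar> / (A * B)"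
    using A B by (simp add: abs_mult)
  also have "\<dots> \<le> B / (A * B)"
  proof (intro divide_right_mono)
    have "0 \<le> c * (c + 1)" "0 \<le> u\<^sup>2"
      using assms by auto
    then show "\<bar>c * (c + 1) - u\<^sup>2\<bar> \<le> B"
      using B by linarith
  qed (use A B in auto)
  also have "\<dots> = 1 / A"
    using B by simp
  also have "\<dots> \<le> 1 / c\<^sup>2"
    using A assms by (intro divide_left_mono) auto
  finally show ?thesis .
qed

section \<open>Integrals of Cauchy kernels\<close>

lemma has_bochner_integral_lborel_FTC_nonneg:
  fixes f F :: "real \<Rightarrow> real"
  assumes F: "\<And>x. (F has_real_derivative f x) (at x)"
    and cont: "\<And>x. isCont f x" and nonneg: "\<And>x. 0 \<le> f x"
    and bot: "(F \<longlongrightarrow> l) at_bot" and top: "(F \<longlongrightarrow> r) at_top"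
  shows "has_bochner_integral lborel f (r - l)"
proof -
  have lim: "((F \<circ> real_of_ereal) \<longlongrightarrow> l) (at_right (-\<infinity>))"
            "((F \<circ> real_of_ereal) \<longlongrightarrow> r) (at_left \<infinity>)"
    using bot top by (simp_all add: ereal_tendsto_simps)
  have "set_integrable lborel (einterval (-\<infinity>) \<infinity>) f"
    by (rule interval_integral_FTC_nonneg[where F = F]) (use assms lim in auto)
  moreover have "(LBINT x=-\<infinity>..\<infinity>. f x) = r - l"
    by (rule interval_integral_FTC_nonneg[where F = F]) (use assms lim in auto)
  ultimately show ?thesis
    by (auto simp: has_bochner_integral_iff interval_lebesgue_integral_def
        set_integrable_def set_lebesgue_integral_def)
qed

lemma tendsto_arctan_divide_at_top:
  assumes "a > 0"
  shows "((\<lambda>u. arctan (u / a)) \<longlongrightarrow> pi / 2) at_top"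
  by (rule filterlim_compose[OF tendsto_arctan_at_top])
     (use assms in real_asymp)

lemma tendsto_arctan_divide_at_bot:
  assumes "a > 0"
  shows "((\<lambda>u. arctan (u / a)) \<longlongrightarrow> - (pi / 2)) at_bot"
  by (rule filterlim_compose[OF tendsto_arctan_at_bot])
     (use assms in real_asymp)

lemma DERIV_arctan_divide:
  assumes "a > 0"
  shows "((\<lambda>u. arctan (u / a)) has_real_derivative cauchy_kernel a u) (at u)"
proof -
  have "(inverse (1 + (u / a)\<^sup>2) * (1 / a)) = cauchy_kernel a u"
    using assms by (simp add: cauchy_kernel_def field_simps power2_eq_square)
  then show ?thesis
    using assms by (auto intro!: derivative_eq_intros simp: field_simps)
qed

lemma isCont_cauchy_kernel: "a > 0 \<Longrightarrow> isCont (cauchy_kernel a) u"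
  unfolding cauchy_kernel_def
  by (intro continuous_intros) (auto simp: add_pos_nonneg less_imp_neq[symmetric])

lemma has_bochner_integral_cauchy_kernel:
  assumes "a > 0"
  shows "has_bochner_integral lborel (cauchy_kernel a) pi"
  using has_bochner_integral_lborel_FTC_nonneg[OF DERIV_arctan_divide isCont_cauchy_kernel
      cauchy_kernel_nonneg tendsto_arctan_divide_at_bot tendsto_arctan_divide_at_top] assms
  by simp

text \<open>
  For \<open>a \<noteq> c\<close> this is a partial fraction decomposition; the case \<open>a = c\<close> has its own antiderivative.
\<close>

lemma has_bochner_integral_cauchy_kernel_mult:
  assumes "a > 0" "c > 0"
  shows "has_bochner_integral lborel (\<lambda>u. cauchy_kernel a u * cauchy_kernel c u) (pi / (a + c))"
proof (cases "a = c")
  case False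
  have ne: "a\<^sup>2 + u\<^sup>2 \<noteq> 0" "c\<^sup>2 + u\<^sup>2 \<noteq> 0" for u
    using assms by (auto simp: add_pos_nonneg less_imp_neq[symmetric])
  have ca: "c\<^sup>2 - a\<^sup>2 \<noteq> 0"
    using False assms by (simp add: power2_eq_iff)
  have "c * cauchy_kernel a u - a * cauchy_kernel c u =
      (c\<^sup>2 - a\<^sup>2) * (cauchy_kernel a u * cauchy_kernel c u)" for u
  proof -
    define A B where "A = a\<^sup>2 + u\<^sup>2" and "B = c\<^sup>2 + u\<^sup>2"
    have "c * (a / A) - a * (c / B) = (B - A) * (a / A * (c / B))"
      using ne[of u] by (simp add: A_def[symmetric] B_def[symmetric] field_simps)
    then show ?thesis
      by (simp add: A_def B_def cauchy_kernel_def)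
  qed
  then have "(\<lambda>u. cauchy_kernel a u * cauchy_kernel c u) =
      (\<lambda>u. (c * cauchy_kernel a u - a * cauchy_kernel c u) / (c\<^sup>2 - a\<^sup>2))"
    using ca by (simp add: fun_eq_iff)
  moreover have "pi / (a + c) = (c * pi - a * pi) / (c\<^sup>2 - a\<^sup>2)"
    using ca assms by (simp add: frac_eq_eq) (simp add: power2_eq_square algebra_simps)
  ultimately show ?thesis
    using assms by (auto intro!: has_bochner_integral_divide_zero has_bochner_integral_diff
        has_bochner_integral_mult_right has_bochner_integral_cauchy_kernel)
next
  case True
  define F where "F = (\<lambda>u. (arctan (u / a) + a * u / (a\<^sup>2 + u\<^sup>2)) / (2 * a))"
  have ne: "a\<^sup>2 + u\<^sup>2 \<noteq> 0" for u
    using assms by (auto simp: add_pos_nonneg less_imp_neq[symmetric])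
  have "has_bochner_integral lborel (\<lambda>u. cauchy_kernel a u * cauchy_kernel a u)
      ((pi/2 + 0) / (2*a) - (-(pi/2) + 0) / (2*a))"
  proof (rule has_bochner_integral_lborel_FTC_nonneg[where F = F])
    fix u
    have "((\<lambda>u. a * u / (a\<^sup>2 + u\<^sup>2)) has_real_derivative
        ((a * (a\<^sup>2 + u\<^sup>2) - (a * u) * (2 * u)) / ((a\<^sup>2 + u\<^sup>2) * (a\<^sup>2 + u\<^sup>2)))) (at u)"
      using ne[of u] by (auto intro!: derivative_eq_intros)
    from DERIV_cdivide[OF DERIV_add[OF DERIV_arctan_divide[OF assms(1)] this], of "2 * a"]
    have "(F has_real_derivative (cauchy_kernel a u +
        ((a * (a\<^sup>2 + u\<^sup>2) - (a * u) * (2 * u)) / ((a\<^sup>2 + u\<^sup>2) * (a\<^sup>2 + u\<^sup>2)))) / (2 * a)) (at u)"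
      by (simp add: F_def)
    also have "(cauchy_kernel a u +
        ((a * (a\<^sup>2 + u\<^sup>2) - (a * u) * (2 * u)) / ((a\<^sup>2 + u\<^sup>2) * (a\<^sup>2 + u\<^sup>2)))) / (2 * a)
        = cauchy_kernel a u * cauchy_kernel a u"
    proof -
      define A where "A = a\<^sup>2 + u\<^sup>2"
      have u: "u * u = A - a * a"
        by (simp add: A_def power2_eq_square)
      have "(a / A + (a * A - 2 * a * (A - a * a)) / (A * A)) / (2 * a) = a / A * (a / A)"
        using assms ne[of u] by (simp add: A_def[symmetric] field_simps)
      moreover have "a * u * (2 * u) = 2 * a * (A - a * a)"
        by (simp add: u[symmetric])
      ultimately show ?thesis
        by (simp only: cauchy_kernel_def A_def[symmetric])
    qed
    finally show "(F has_real_derivative cauchy_kernel a u * cauchy_kernel a u) (at u)" .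
  next
    have "((\<lambda>u. a * u / (a\<^sup>2 + u\<^sup>2)) \<longlongrightarrow> 0) at_top" "((\<lambda>u. a * u / (a\<^sup>2 + u\<^sup>2)) \<longlongrightarrow> 0) at_bot"
      using assms by real_asymp+
    then show "(F \<longlongrightarrow> (pi/2 + 0) / (2*a)) at_top" "(F \<longlongrightarrow> (-(pi/2) + 0) / (2*a)) at_bot"
      unfolding F_def using assms
      by (intro tendsto_divide tendsto_add tendsto_const tendsto_arctan_divide_at_top
          tendsto_arctan_divide_at_bot; simp)+
  qed (use assms in \<open>auto intro!: continuous_intros isCont_cauchy_kernel simp: cauchy_kernel_nonneg\<close>)
  then show ?thesis
    using True by (simp add: field_simps)
qed

section \<open>The density sech\<close>

lemma sech_pos: "sech u > 0"
  by (simp add: sech_def)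

lemma sech_minus: "sech (- u) = sech u"
  by (simp add: sech_def)

lemma isCont_sech: "isCont (\<lambda>u. sech (c * u)) u"
  unfolding sech_def by (intro continuous_intros) simp

lemma borel_measurable_sech [measurable]: "sech \<in> borel_measurable borel"
  using isCont_sech[where c = 1] by (intro borel_measurable_continuous_onI continuous_at_imp_continuous_on) auto

lemma has_bochner_integral_sech_pi: "has_bochner_integral lborel (\<lambda>u. sech (pi * u)) 1"
proof -
  have "has_bochner_integral lborel (\<lambda>u. sech (pi * u)) ((pi / 2) / pi - (- (pi / 2)) / pi)"
  proof (rule has_bochner_integral_lborel_FTC_nonneg[where F = "\<lambda>u. arctan (sinh (pi * u)) / pi"])
    fix u
    have "1 + (sinh (pi * u))\<^sup>2 = (cosh (pi * u))\<^sup>2"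
      by (simp add: cosh_square_eq)
    then have "inverse (1 + (sinh (pi * u))\<^sup>2) * (cosh (pi * u) * pi) / pi = sech (pi * u)"
      by (simp only: sech_def) (simp add: power2_eq_square inverse_eq_divide)
    then show "((\<lambda>u. arctan (sinh (pi * u)) / pi) has_real_derivative sech (pi * u)) (at u)"
      by (auto intro!: derivative_eq_intros simp: algebra_simps)
  next
    have *: "filterlim (\<lambda>u. pi * u) at_top at_top" "filterlim (\<lambda>u. pi * u) at_bot at_bot"
      by (auto intro!: filterlim_tendsto_pos_mult_at_top[OF tendsto_const]
          filterlim_tendsto_pos_mult_at_bot[OF tendsto_const] filterlim_ident)
    show "((\<lambda>u. arctan (sinh (pi * u)) / pi) \<longlongrightarrow> (pi / 2) / pi) at_top"
      by (intro tendsto_divide tendsto_const filterlim_compose[OF tendsto_arctan_at_top]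
          filterlim_compose[OF sinh_real_at_top *(1)]) simp
    show "((\<lambda>u. arctan (sinh (pi * u)) / pi) \<longlongrightarrow> (- (pi / 2)) / pi) at_bot"
      by (intro tendsto_divide tendsto_const filterlim_compose[OF tendsto_arctan_at_bot]
          filterlim_compose[OF sinh_real_at_bot *(2)]) simp
  qed (auto simp: isCont_sech sech_pos less_imp_le)
  then show ?thesis
    by simp
qed

lemma sinh_real_ge: "x \<le> sinh x" if "x \<ge> 0" for x :: real
proof -
  have "sinh 0 - 0 \<le> sinh x - x"
  proof (rule DERIV_nonneg_imp_nondecreasing[OF that])
    fix y :: real
    show "\<exists>d. ((\<lambda>x. sinh x - x) has_real_derivative d) (at y) \<and> 0 \<le> d"
      by (rule exI[of _ "cosh y - 1"])
         (auto intro!: derivative_eq_intros simp: cosh_real_ge_1)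
  qed
  then show ?thesis by simp
qed

lemma cosh_real_ge_quadratic: "1 + x\<^sup>2 / 2 \<le> cosh x" for x :: real
proof -
  have "(\<bar>x\<bar> / 2)\<^sup>2 \<le> (sinh (\<bar>x\<bar> / 2))\<^sup>2"
    by (intro power_mono sinh_real_ge) auto
  moreover have "cosh \<bar>x\<bar> = 1 + 2 * (sinh (\<bar>x\<bar> / 2))\<^sup>2"
    using cosh_double[of "\<bar>x\<bar> / 2"] by (simp add: cosh_square_eq)
  ultimately show ?thesis
    by (simp add: power_divide)
qed

text \<open>
  Obtained from \<open>cosh (\<pi> u) = 2 cosh\<^sup>2 (\<pi> u / 2) - 1\<close> and \<open>cosh (\<pi> u / 2) \<ge> 1 + \<pi>\<^sup>2 u\<^sup>2 / 8 \<ge> 1 + u\<^sup>2\<close>.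
  Hence \<open>sech (\<pi> u)\<close> times a function bounded by \<open>1 + u\<^sup>2\<close> is dominated by \<open>1 / (1 + u\<^sup>2)\<close>.
\<close>

lemma sech_pi_le: "sech (pi * u) \<le> 1 / (1 + u\<^sup>2)\<^sup>2"
proof -
  have "8 * u\<^sup>2 \<le> pi\<^sup>2 * u\<^sup>2"
  proof (rule mult_right_mono)
    have "3\<^sup>2 \<le> pi\<^sup>2"
      using pi_gt3 by (intro power_mono) auto
    then show "8 \<le> pi\<^sup>2" by simp
  qed simp
  then have "1 + u\<^sup>2 \<le> 1 + (pi * u / 2)\<^sup>2 / 2"
    by (simp add: power_mult_distrib power_divide)
  also have "\<dots> \<le> cosh (pi * u / 2)"
    by (rule cosh_real_ge_quadratic)
  finally have "(1 + u\<^sup>2)\<^sup>2 \<le> (cosh (pi * u / 2))\<^sup>2"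
    by (intro power_mono) auto
  moreover have pos: "(1 + u\<^sup>2)\<^sup>2 \<ge> 1"
    by (simp add: one_le_power)
  moreover have "cosh (pi * u) = 2 * (cosh (pi * u / 2))\<^sup>2 - 1"
    using cosh_double_cosh[of "pi * u / 2"] by simp
  ultimately have "(1 + u\<^sup>2)\<^sup>2 \<le> cosh (pi * u)"
    by linarith
  then show ?thesis
    unfolding sech_def using pos by (intro divide_left_mono mult_pos_pos) (simp, simp, simp, linarith)
qed

lemma sech_pi_mult_le_cauchy_kernel:
  assumes "g \<le> 1 + u\<^sup>2" "0 \<le> g"
  shows "sech (pi * u) * g \<le> cauchy_kernel 1 u"
proof -
  have pos: "1 + u\<^sup>2 > 0"
    by (simp add: add_pos_nonneg)
  have "sech (pi * u) * g \<le> 1 / (1 + u\<^sup>2)\<^sup>2 * (1 + u\<^sup>2)"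
    using assms by (intro mult_mono sech_pi_le) auto
  also have "\<dots> = cauchy_kernel 1 u"
    using pos by (simp add: cauchy_kernel_def power2_eq_square)
  finally show ?thesis .
qed

section \<open>The Cauchy kernel integrated against sech\<close>

lemma summable_inverse_arith_prog_square:
  "summable (\<lambda>k. 1 / (2 * real k + 1/2)\<^sup>2)"
proof (rule summable_comparison_test')
  show "summable (\<lambda>k. 4 * inverse (real (Suc k) ^ 2))"
    using inverse_power_summable[of 2, where 'a = real]
    by (intro summable_mult) (subst summable_Suc_iff, simp)
next
  fix k :: nat
  have "(real (Suc k) / 2)\<^sup>2 \<le> (2 * real k + 1/2)\<^sup>2"
    by (intro power_mono) auto
  then have "1 / (2 * real k + 1/2)\<^sup>2 \<le> 1 / (real (Suc k) / 2)\<^sup>2"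
    by (intro divide_left_mono mult_pos_pos zero_less_power) auto
  also have "\<dots> = 4 * inverse (real (Suc k) ^ 2)"
    by (simp add: power_divide field_simps)
  finally show "norm (1 / (2 * real k + 1/2)\<^sup>2) \<le> 4 * inverse (real (Suc k) ^ 2)"
    by simp
qed

lemma has_bochner_integral_sech_cauchy_kernel:
  assumes "t > 0"
  shows "has_bochner_integral lborel (\<lambda>u. sech (pi * u) * cauchy_kernel t u)
     (Digamma (3/4 + t/2) - Digamma (1/4 + t/2))"
proof -
  define c where "c = (\<lambda>k. 2 * real k + 1/2)"
  have c: "c k > 0" "2 * real k + 3/2 = c k + 1" for k
    by (auto simp: c_def)
  define f where "f = (\<lambda>k u. cauchy_kernel t u * (2 * (cauchy_kernel (c k) u - cauchy_kernel (c k + 1) u)))"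
  have f_int: "has_bochner_integral lborel (f k) (2 * (pi / (t + c k) - pi / (t + (c k + 1))))" for k
  proof -
    have "f k = (\<lambda>u. 2 * (cauchy_kernel t u * cauchy_kernel (c k) u - cauchy_kernel t u * cauchy_kernel (c k + 1) u))"
      by (simp add: f_def fun_eq_iff algebra_simps)
    moreover have "has_bochner_integral lborel
        (\<lambda>u. 2 * (cauchy_kernel t u * cauchy_kernel (c k) u - cauchy_kernel t u * cauchy_kernel (c k + 1) u))
        (2 * (pi / (t + c k) - pi / (t + (c k + 1))))"
      using assms c(1)[of k]
      by (intro has_bochner_integral_mult_right has_bochner_integral_diff
          has_bochner_integral_cauchy_kernel_mult) auto
    ultimately show ?thesis
      by simp
  qed
  have f_le: "norm (f k u) \<le> 2 * (1 / (c k)\<^sup>2) * cauchy_kernel t u" for k u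
    using mult_left_mono[OF abs_cauchy_kernel_diff_le[OF c(1), of k u], of "2 * cauchy_kernel t u"] assms
    by (simp add: f_def abs_mult cauchy_kernel_nonneg mult_ac del: right_diff_distrib_numeral)
  have sum_c: "summable (\<lambda>k. 1 / (c k)\<^sup>2)"
    using summable_inverse_arith_prog_square by (simp add: c_def)
  have f_sums: "(\<lambda>k. f k u) sums (pi * (sech (pi * u) * cauchy_kernel t u))" for u
  proof -
    have "f k u = cauchy_kernel t u *
        (2 * (cauchy_kernel (2 * real k + 1/2) u - cauchy_kernel (2 * real k + 3/2) u))" for k
      by (simp only: f_def c(2)) (simp only: c_def)
    with sums_mult[OF sech_partial_fractions[of u], of "cauchy_kernel t u"] show ?thesis
      by (simp only: mult_ac)
  qed
  have 1: "summable (\<lambda>k. norm (f k u))" for u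
    by (rule summable_comparison_test'[where g = "\<lambda>k. 2 * (1 / (c k)\<^sup>2) * cauchy_kernel t u" and N = 0])
       (use f_le sum_c in \<open>auto intro!: summable_mult summable_mult2 simp del: times_divide_eq_right\<close>)
  have 2: "summable (\<lambda>k. \<integral>u. norm (f k u) \<partial>lborel)"
  proof (rule summable_comparison_test'[where g = "\<lambda>k. 2 * (1 / (c k)\<^sup>2) * pi" and N = 0])
    fix k
    have "(\<integral>u. norm (f k u) \<partial>lborel) \<le> (\<integral>u. 2 * (1 / (c k)\<^sup>2) * cauchy_kernel t u \<partial>lborel)"
      using has_bochner_integral_cauchy_kernel[OF assms] f_int[of k] f_le
      by (intro integral_mono integrable_mult_right integrable_norm) (auto simp: has_bochner_integral_iff)
    also have "\<dots> = 2 * (1 / (c k)\<^sup>2) * pi"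
      using has_bochner_integral_cauchy_kernel[OF assms] by (simp add: has_bochner_integral_iff)
    finally show "norm (\<integral>u. norm (f k u) \<partial>lborel) \<le> 2 * (1 / (c k)\<^sup>2) * pi"
      by simp
  qed (use sum_c in \<open>auto intro!: summable_mult summable_mult2 simp del: times_divide_eq_right\<close>)
  have "integrable lborel (\<lambda>u. \<Sum>k. f k u)"
    "(\<lambda>k. integral\<^sup>L lborel (f k)) sums (\<integral>u. (\<Sum>k. f k u) \<partial>lborel)"
    by (rule integrable_suminf sums_integral; use f_int 1 2 in \<open>auto simp: has_bochner_integral_iff\<close>)+
  then have int: "integrable lborel (\<lambda>u. sech (pi * u) * cauchy_kernel t u)"
    and sums1: "(\<lambda>k. 2 * (pi / (t + c k) - pi / (t + (c k + 1)))) sums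
      (pi * (\<integral>u. sech (pi * u) * cauchy_kernel t u \<partial>lborel))"
    using f_int by (simp_all add: sums_unique[OF f_sums, symmetric] has_bochner_integral_iff)
  have Dig: "(\<lambda>k. inverse (of_nat (Suc k)) - inverse (w + of_nat k)) sums
      (Digamma w + euler_mascheroni)" if "w > 0" for w :: real
    using summable_Digamma[of w] that by (simp add: Digamma_def summable_sums)
  have "(\<lambda>k. inverse (1/4 + t/2 + real k) - inverse (3/4 + t/2 + real k)) sums
      (Digamma (3/4 + t/2) - Digamma (1/4 + t/2))"
    using sums_diff[OF Dig[of "3/4 + t/2"] Dig[of "1/4 + t/2"]] assms by simp
  from sums_mult[OF this, of pi]
  have "(\<lambda>k. pi * (inverse (1/4 + t/2 + real k) - inverse (3/4 + t/2 + real k))) sums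
      (pi * (Digamma (3/4 + t/2) - Digamma (1/4 + t/2)))" .
  moreover have "pi * (inverse (1/4 + t/2 + real k) - inverse (3/4 + t/2 + real k)) =
      2 * (pi / (t + c k) - pi / (t + (c k + 1)))" for k
  proof -
    have "1/4 + t/2 + real k = (t + c k) / 2" "3/4 + t/2 + real k = (t + (c k + 1)) / 2"
      by (simp_all add: c_def field_simps)
    then show ?thesis
      by (simp only: inverse_eq_divide divide_divide_eq_right) (simp add: algebra_simps)
  qed
  ultimately have "pi * (\<integral>u. sech (pi * u) * cauchy_kernel t u \<partial>lborel) =
      pi * (Digamma (3/4 + t/2) - Digamma (1/4 + t/2))"
    using sums1 by (simp add: sums_iff)
  with int show ?thesis
    by (simp add: has_bochner_integral_iff)
qed

section \<open>Increments of the logarithmic integral\<close>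

text \<open>The real part \<open>ln \<bar>a + \<i> u\<bar>\<close> of the logarithm on the vertical line through \<open>a\<close>.\<close>

definition half_ln_sq :: "real \<Rightarrow> real \<Rightarrow> real" where
  "half_ln_sq a u = ln (a\<^sup>2 + u\<^sup>2) / 2"

text \<open>
  The logarithm of \<open>(\<Gamma>(3/4 + a/2) / \<Gamma>(1/4 + a/2))\<^sup>2\<close> for \<open>a \<ge> 0\<close>, written with \<open>ln_Gamma\<close> so that its
  derivative is a difference of Digamma values.
\<close>

definition ln_Gamma_quot :: "real \<Rightarrow> real" where
  "ln_Gamma_quot a = 2 * (ln_Gamma (3/4 + a/2) - ln_Gamma (1/4 + a/2))"

lemma borel_measurable_half_ln_sq [measurable]: "half_ln_sq a \<in> borel_measurable borel"
  unfolding half_ln_sq_def by measurable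

lemma half_ln_sq_mono:
  assumes "0 \<le> a" "a \<le> b" "u \<noteq> 0"
  shows "half_ln_sq a u \<le> half_ln_sq b u"
  using assms by (simp add: half_ln_sq_def add_nonneg_pos power_mono)

lemma nn_integral_cauchy_kernel_interval:
  assumes "0 \<le> a" "a \<le> b" "u \<noteq> 0"
  shows "(\<integral>\<^sup>+t. ennreal (cauchy_kernel t u) * indicator {a..b} t \<partial>lborel) =
    ennreal (half_ln_sq b u - half_ln_sq a u)"
proof (rule nn_integral_FTC_Icc)
  fix t
  have "t\<^sup>2 + u\<^sup>2 > 0"
    using assms by (simp add: add_nonneg_pos)
  then have "((\<lambda>t. ln (t\<^sup>2 + u\<^sup>2)) has_real_derivative 2 * cauchy_kernel t u) (at t)"
    unfolding cauchy_kernel_def by (auto intro!: derivative_eq_intros)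
  from DERIV_cdivide[OF this, of 2]
  show "((\<lambda>t. half_ln_sq t u) has_real_derivative cauchy_kernel t u) (at t)"
    by (simp add: half_ln_sq_def)
  show "t \<in> {a..b} \<Longrightarrow> 0 \<le> cauchy_kernel t u"
    using assms by (simp add: cauchy_kernel_nonneg)
qed (use assms in auto)

lemma DERIV_ln_Gamma_quot:
  assumes "t \<ge> 0"
  shows "(ln_Gamma_quot has_real_derivative (Digamma (3/4 + t/2) - Digamma (1/4 + t/2))) (at t)"
  unfolding ln_Gamma_quot_def using assms
  by (auto intro!: derivative_eq_intros simp: algebra_simps)

lemma has_bochner_integral_half_ln_sq_diff:
  assumes "0 \<le> a" "a \<le> b"
  shows "has_bochner_integral lborel (\<lambda>u. sech (pi * u) * (half_ln_sq b u - half_ln_sq a u))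
    (ln_Gamma_quot b - ln_Gamma_quot a)"
proof -
  (* Extended by 0 to negative t so that D is nonnegative and measurable on the whole line. *)
  define D :: "real \<Rightarrow> real" where "D = (\<lambda>t. if t \<ge> 0 then Digamma (3/4 + t/2) - Digamma (1/4 + t/2) else 0)"
  have D_nonneg: "D t \<ge> 0" for t
    unfolding D_def by (auto intro!: Digamma_real_mono)
  have [measurable]: "D \<in> borel_measurable borel"
  proof -
    have "continuous_on {0..} (\<lambda>t::real. Digamma (3/4 + t/2) - Digamma (1/4 + t/2))"
      by (intro continuous_at_imp_continuous_on ballI continuous_intros)
         (auto elim!: nonpos_Ints_cases)
    then have "(\<lambda>t. if t \<in> {0..} then Digamma (3/4 + t/2) - Digamma (1/4 + t/2) else (0::real)) \<in> borel_measurable borel"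
      by (intro borel_measurable_continuous_on_if continuous_on_const) auto
    then show ?thesis
      by (simp add: D_def)
  qed
  have mono: "AE u in lborel. half_ln_sq a u \<le> half_ln_sq b u"
    using AE_lborel_singleton[of 0] by eventually_elim (use assms half_ln_sq_mono in auto)
  have G_mono: "ln_Gamma_quot a \<le> ln_Gamma_quot b"
    by (rule DERIV_nonneg_imp_nondecreasing[OF assms(2)])
       (use assms DERIV_ln_Gamma_quot D_nonneg in \<open>fastforce simp: D_def split: if_splits\<close>)
  have "(\<integral>\<^sup>+u. ennreal (sech (pi * u) * (half_ln_sq b u - half_ln_sq a u)) \<partial>lborel) =
      (\<integral>\<^sup>+u. (\<integral>\<^sup>+t. ennreal (sech (pi * u) * cauchy_kernel t u) * indicator {a..b} t \<partial>lborel) \<partial>lborel)"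
  proof (rule nn_integral_cong_AE)
    show "AE u in lborel. ennreal (sech (pi * u) * (half_ln_sq b u - half_ln_sq a u)) =
        (\<integral>\<^sup>+t. ennreal (sech (pi * u) * cauchy_kernel t u) * indicator {a..b} t \<partial>lborel)"
      using AE_lborel_singleton[of 0]
    proof eventually_elim
      case (elim u)
      have "(\<integral>\<^sup>+t. ennreal (sech (pi * u) * cauchy_kernel t u) * indicator {a..b} t \<partial>lborel) =
         ennreal (sech (pi * u)) * (\<integral>\<^sup>+t. ennreal (cauchy_kernel t u) * indicator {a..b} t \<partial>lborel)"
        by (simp add: ennreal_mult' sech_pos less_imp_le mult.assoc nn_integral_cmult)
      then show ?case
        using elim assms
        by (simp add: nn_integral_cauchy_kernel_interval ennreal_mult' sech_pos less_imp_le)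
    qed
  qed
  also have "\<dots> = (\<integral>\<^sup>+t. (\<integral>\<^sup>+u. ennreal (sech (pi * u) * cauchy_kernel t u) * indicator {a..b} t \<partial>lborel) \<partial>lborel)"
    by (rule lborel_pair.Fubini') measurable
  also have "\<dots> = (\<integral>\<^sup>+t. ennreal (D t) * indicator {a..b} t \<partial>lborel)"
  proof (rule nn_integral_cong_AE)
    show "AE t in lborel. (\<integral>\<^sup>+u. ennreal (sech (pi * u) * cauchy_kernel t u) * indicator {a..b} t \<partial>lborel) =
        ennreal (D t) * indicator {a..b} t"
      (* At t = 0 the inner integral is 0 while D 0 is positive. *)
      using AE_lborel_singleton[of 0]
    proof eventually_elim
      case (elim t)
      show ?case
      proof (cases "t \<in> {a..b}")
        case True
        then have t: "t > 0"
          using assms elim by auto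
        have "(\<integral>\<^sup>+u. ennreal (sech (pi * u) * cauchy_kernel t u) \<partial>lborel) = ennreal (D t)"
          using has_bochner_integral_sech_cauchy_kernel[OF t] t
          by (subst nn_integral_eq_integral)
             (auto simp: has_bochner_integral_iff D_def cauchy_kernel_nonneg sech_pos less_imp_le)
        with True show ?thesis by simp
      qed simp
    qed
  qed
  also have "\<dots> = ennreal (ln_Gamma_quot b - ln_Gamma_quot a)"
  proof (rule nn_integral_FTC_Icc)
    fix t assume "t \<in> {a..b}"
    then show "(ln_Gamma_quot has_real_derivative D t) (at t)"
      using assms DERIV_ln_Gamma_quot[of t] by (simp add: D_def)
  qed (use assms D_nonneg in auto)
  finally show ?thesis
    using mono G_mono
    by (intro has_bochner_integral_nn_integral) (auto simp: sech_pos less_imp_le)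
qed

lemma integrable_half_ln_sq:
  assumes "a \<ge> 0"
  shows "integrable lborel (\<lambda>u. sech (pi * u) * half_ln_sq a u)"
proof -
  have 1: "integrable lborel (\<lambda>u. sech (pi * u) * half_ln_sq 1 u)"
  proof (rule Bochner_Integration.integrable_bound)
    show "integrable lborel (cauchy_kernel 1)"
      using has_bochner_integral_cauchy_kernel[of 1] by (simp add: has_bochner_integral_iff)
    have "ln (1 + u\<^sup>2) \<le> u\<^sup>2" for u :: real
      by (rule ln_add_one_self_le_self) simp
    then have "0 \<le> half_ln_sq 1 u" "half_ln_sq 1 u \<le> 1 + u\<^sup>2" for u
      by (auto simp: half_ln_sq_def intro: order_trans[of _ "u\<^sup>2"])
    then show "AE u in lborel. norm (sech (pi * u) * half_ln_sq 1 u) \<le> norm (cauchy_kernel 1 u)"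
      using sech_pi_mult_le_cauchy_kernel
      by (intro AE_I2) (simp add: abs_mult sech_pos less_imp_le cauchy_kernel_nonneg)
  qed measurable
  show ?thesis
  proof (cases "a \<le> 1")
    case True
    then have "integrable lborel (\<lambda>u. sech (pi * u) * half_ln_sq 1 u -
        sech (pi * u) * (half_ln_sq 1 u - half_ln_sq a u))"
      using has_bochner_integral_half_ln_sq_diff[of a 1] assms 1
      by (intro Bochner_Integration.integrable_diff) (auto simp: has_bochner_integral_iff)
    then show ?thesis by (simp add: algebra_simps)
  next
    case False
    then have "integrable lborel (\<lambda>u. sech (pi * u) * half_ln_sq 1 u +
        sech (pi * u) * (half_ln_sq a u - half_ln_sq 1 u))"
      using has_bochner_integral_half_ln_sq_diff[of 1 a] assms 1
      by (intro Bochner_Integration.integrable_add) (auto simp: has_bochner_integral_iff)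
    then show ?thesis by (simp add: algebra_simps)
  qed
qed

section \<open>Behaviour at infinity\<close>

text \<open>
  Both bounds are midpoint log-convexity \<open>\<Gamma>(x + 1/2)\<^sup>2 \<le> \<Gamma>(x) \<Gamma>(x + 1)\<close>, taken at \<open>x = z\<close> and at
  \<open>x = z - 1/2\<close>.
\<close>

lemma Gamma_half_shift_bounds:
  fixes z :: real
  assumes "z > 1/2"
  shows "z - 1/2 \<le> (Gamma (z + 1/2) / Gamma z)\<^sup>2" "(Gamma (z + 1/2) / Gamma z)\<^sup>2 \<le> z"
proof -
  have mid: "(Gamma (x + 1/2))\<^sup>2 \<le> Gamma x * Gamma (x + 1)" if x: "x > 0" for x :: real
  proof -
    have "(ln \<circ> Gamma) ((1 - 1/2) *\<^sub>R x + (1/2) *\<^sub>R (x + 1)) \<le>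
       (1 - 1/2) * (ln \<circ> Gamma) x + (1/2) * (ln \<circ> Gamma) (x + 1)"
      by (rule convex_onD[OF log_convex_Gamma_real]) (use x in auto)
    moreover have "(1 - 1/2) *\<^sub>R x + (1/2) *\<^sub>R (x + 1) = x + 1/2"
      by (simp add: field_simps)
    ultimately have "2 * ln (Gamma (x + 1/2)) \<le> ln (Gamma x) + ln (Gamma (x + 1))"
      by simp
    moreover have "Gamma x > 0" "Gamma (x + 1) > 0" "Gamma (x + 1/2) > 0"
      using x by (auto intro!: Gamma_real_pos)
    ultimately have "ln ((Gamma (x + 1/2))\<^sup>2) \<le> ln (Gamma x * Gamma (x + 1))"
      by (simp add: ln_mult ln_realpow)
    then show ?thesis
      using \<open>Gamma x > 0\<close> \<open>Gamma (x + 1) > 0\<close> \<open>Gamma (x + 1/2) > 0\<close> by simp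
  qed
  have pos: "Gamma z > 0" "Gamma (z - 1/2) > 0"
    using assms by (auto intro!: Gamma_real_pos)
  have rec: "Gamma (z + 1) = z * Gamma z" "Gamma (z + 1/2) = (z - 1/2) * Gamma (z - 1/2)"
    using Gamma_plus1[of z] Gamma_plus1[of "z - 1/2"] assms
      nonpos_Ints_nonpos[of z] nonpos_Ints_nonpos[of "z - 1/2"]
    by (fastforce simp: add.commute)+
  show "(Gamma (z + 1/2) / Gamma z)\<^sup>2 \<le> z"
    using mid[of z] rec pos assms by (simp add: field_simps power2_eq_square)
  have "(z - 1/2) * (Gamma z)\<^sup>2 \<le> (z - 1/2) * (Gamma (z - 1/2) * Gamma (z + 1/2))"
    using mid[of "z - 1/2"] assms by (intro mult_left_mono) (auto simp: add.commute)
  also have "\<dots> = (Gamma (z + 1/2))\<^sup>2"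
    by (simp add: rec power2_eq_square)
  finally show "z - 1/2 \<le> (Gamma (z + 1/2) / Gamma z)\<^sup>2"
    using pos by (simp add: power_divide le_divide_eq)
qed

lemma ln_Gamma_quot_eq:
  assumes "a \<ge> 0"
  shows "ln_Gamma_quot a = ln ((Gamma (3/4 + a/2) / Gamma (1/4 + a/2))\<^sup>2)"
proof -
  have "Gamma (3/4 + a/2) > 0" "Gamma (1/4 + a/2) > 0"
    using assms by (auto intro!: Gamma_real_pos)
  then show ?thesis
    using assms by (simp add: ln_Gamma_quot_def ln_Gamma_real_pos ln_realpow ln_div less_imp_neq[symmetric])
qed

lemma tendsto_ln_Gamma_quot:
  "((\<lambda>a. ln_Gamma_quot a + ln 2 - ln a) \<longlongrightarrow> 0) at_top"
proof (rule tendsto_sandwich[of "\<lambda>a. ln (a - 1/2) - ln a" _ _ "\<lambda>a. ln (a + 1/2) - ln a"])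
  have bounds: "ln (a - 1/2) \<le> ln_Gamma_quot a + ln 2" "ln_Gamma_quot a + ln 2 \<le> ln (a + 1/2)"
    if a: "a > 1" for a :: real
  proof -
    define q where "q = (Gamma (3/4 + a/2) / Gamma (1/4 + a/2))\<^sup>2"
    have "a/2 - 1/4 \<le> q" "q \<le> a/2 + 1/4"
      using Gamma_half_shift_bounds[of "1/4 + a/2"] a by (simp_all add: q_def add_ac)
    moreover have "ln_Gamma_quot a + ln 2 = ln (2 * q)" if "q > 0"
      using a that by (simp add: ln_Gamma_quot_eq q_def ln_mult)
    ultimately show "ln (a - 1/2) \<le> ln_Gamma_quot a + ln 2" "ln_Gamma_quot a + ln 2 \<le> ln (a + 1/2)"
      using a by auto
  qed
  show "eventually (\<lambda>a. ln (a - 1/2) - ln a \<le> ln_Gamma_quot a + ln 2 - ln a) at_top"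
       "eventually (\<lambda>a. ln_Gamma_quot a + ln 2 - ln a \<le> ln (a + 1/2) - ln a) at_top"
    using eventually_gt_at_top[of 1] by (eventually_elim; use bounds in force)+
  show "((\<lambda>a::real. ln (a - 1/2) - ln a) \<longlongrightarrow> 0) at_top" "((\<lambda>a::real. ln (a + 1/2) - ln a) \<longlongrightarrow> 0) at_top"
    by real_asymp+
qed

lemma tendsto_integral_half_ln_sq:
  "((\<lambda>a. (\<integral>u. sech (pi * u) * half_ln_sq a u \<partial>lborel) - ln a) \<longlongrightarrow> 0) at_top"
proof (rule tendsto_sandwich[of "\<lambda>_. 0" _ _ "\<lambda>a. pi / a\<^sup>2"])
  have bounds: "0 \<le> (\<integral>u. sech (pi * u) * half_ln_sq a u \<partial>lborel) - ln a \<and>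
      (\<integral>u. sech (pi * u) * half_ln_sq a u \<partial>lborel) - ln a \<le> pi / a\<^sup>2" if a: "a > 0" for a :: real
  proof -
    define r where "r = (\<lambda>u. half_ln_sq a u - ln a)"
    have r: "0 \<le> r u" "r u \<le> (1 + u\<^sup>2) / a\<^sup>2" for u
    proof -
      have "a\<^sup>2 + u\<^sup>2 = a\<^sup>2 * (1 + u\<^sup>2 / a\<^sup>2)"
        using a by (simp add: field_simps)
      moreover have "1 + u\<^sup>2 / a\<^sup>2 > 0"
        using a by (simp add: add_pos_nonneg)
      ultimately have "r u = ln (1 + u\<^sup>2 / a\<^sup>2) / 2"
        using a by (simp add: r_def half_ln_sq_def ln_mult ln_realpow add_divide_distrib)
      moreover have "0 \<le> ln (1 + u\<^sup>2 / a\<^sup>2)" "ln (1 + u\<^sup>2 / a\<^sup>2) \<le> u\<^sup>2 / a\<^sup>2"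
        by (auto intro!: ln_add_one_self_le_self)
      moreover have "0 \<le> u\<^sup>2 / a\<^sup>2" "u\<^sup>2 / a\<^sup>2 \<le> (1 + u\<^sup>2) / a\<^sup>2"
        by (auto intro!: divide_right_mono)
      ultimately show "0 \<le> r u" "r u \<le> (1 + u\<^sup>2) / a\<^sup>2"
        by linarith+
    qed
    have le: "sech (pi * u) * r u \<le> cauchy_kernel 1 u / a\<^sup>2" for u
      using sech_pi_mult_le_cauchy_kernel[of "a\<^sup>2 * r u" u] r[of u] a
      by (simp add: field_simps)
    have int: "integrable lborel (\<lambda>u. sech (pi * u) * half_ln_sq a u)"
              "integrable lborel (\<lambda>u. sech (pi * u) * ln a)"
      using has_bochner_integral_sech_pi integrable_half_ln_sq[of a] a
      by (auto simp: has_bochner_integral_iff)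
    have ck: "integrable lborel (\<lambda>u. cauchy_kernel 1 u / a\<^sup>2)"
      "(\<integral>u. cauchy_kernel 1 u / a\<^sup>2 \<partial>lborel) = pi / a\<^sup>2"
      using has_bochner_integral_cauchy_kernel[of 1] by (auto simp: has_bochner_integral_iff)
    have eq: "sech (pi * u) * r u = sech (pi * u) * half_ln_sq a u - sech (pi * u) * ln a" for u
      by (simp add: r_def algebra_simps)
    have "(\<integral>u. sech (pi * u) * half_ln_sq a u \<partial>lborel) - ln a = (\<integral>u. sech (pi * u) * r u \<partial>lborel)"
      unfolding eq using int has_bochner_integral_sech_pi
      by (simp add: Bochner_Integration.integral_diff has_bochner_integral_iff)
    moreover have "(\<integral>u. sech (pi * u) * r u \<partial>lborel) \<le> (\<integral>u. cauchy_kernel 1 u / a\<^sup>2 \<partial>lborel)"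
      using int ck le by (intro integral_mono) (simp_all add: eq)
    moreover have "0 \<le> (\<integral>u. sech (pi * u) * r u \<partial>lborel)"
      using r by (intro integral_nonneg_AE) (simp add: sech_pos less_imp_le)
    ultimately show ?thesis
      using ck(2) by linarith
  qed
  show "eventually (\<lambda>a. 0 \<le> (\<integral>u. sech (pi * u) * half_ln_sq a u \<partial>lborel) - ln a) at_top"
       "eventually (\<lambda>a. (\<integral>u. sech (pi * u) * half_ln_sq a u \<partial>lborel) - ln a \<le> pi / a\<^sup>2) at_top"
    using eventually_gt_at_top[of 0] by (eventually_elim; use bounds in blast)+
  show "((\<lambda>a. pi / a\<^sup>2) \<longlongrightarrow> 0) at_top"
    by real_asymp
qed simp

lemma integral_half_ln_sq:
  assumes "a \<ge> 0"
  shows "(\<integral>u. sech (pi * u) * half_ln_sq a u \<partial>lborel) =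
    ln (2 * ((Gamma (3/4 + a/2))\<^sup>2 / (Gamma (1/4 + a/2))\<^sup>2))"
proof -
  define I where "I = (\<lambda>a. \<integral>u. sech (pi * u) * half_ln_sq a u \<partial>lborel)"
  have "eventually (\<lambda>b. (I b - ln b) - (ln_Gamma_quot b + ln 2 - ln b) = I a - ln_Gamma_quot a - ln 2) at_top"
    using eventually_ge_at_top[of a]
  proof eventually_elim
    case (elim b)
    have "I b - I a = (\<integral>u. sech (pi * u) * (half_ln_sq b u - half_ln_sq a u) \<partial>lborel)"
      using assms elim by (simp add: I_def right_diff_distrib Bochner_Integration.integral_diff
          integrable_half_ln_sq)
    also have "\<dots> = ln_Gamma_quot b - ln_Gamma_quot a"
      using has_bochner_integral_half_ln_sq_diff[OF assms elim] by (simp add: has_bochner_integral_iff)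
    finally show ?case by simp
  qed
  moreover have "((\<lambda>b. (I b - ln b) - (ln_Gamma_quot b + ln 2 - ln b)) \<longlongrightarrow> 0 - 0) at_top"
    unfolding I_def by (intro tendsto_diff tendsto_integral_half_ln_sq tendsto_ln_Gamma_quot)
  ultimately have "((\<lambda>b::real. I a - ln_Gamma_quot a - ln 2) \<longlongrightarrow> 0) at_top"
    using tendsto_cong by fastforce
  then have "I a = ln 2 + ln_Gamma_quot a"
    by (simp add: tendsto_const_iff)
  moreover have "Gamma (3/4 + a/2) > 0" "Gamma (1/4 + a/2) > 0"
    using assms by (auto intro!: Gamma_real_pos)
  ultimately show ?thesis
    using assms by (simp add: I_def ln_Gamma_quot_eq power_divide)
       (simp add: ln_mult ln_div less_imp_neq[symmetric])
qed

section \<open>The complex logarithm on a vertical line\<close>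

text \<open>
  The point \<open>u = 0\<close> is excluded here and below: the line may meet the branch cut or the origin there,
  and \<open>Ln 0\<close> is unspecified. It is a null set.
\<close>

lemma Re_Ln_vertical_line:
  assumes "u \<noteq> 0"
  shows "Re (Ln (of_real y + \<i> * of_real u)) = half_ln_sq \<bar>y\<bar> u"
proof -
  have "of_real y + \<i> * of_real u \<noteq> (0::complex)"
    using assms by (auto simp: complex_eq_iff)
  moreover have "norm (of_real y + \<i> * of_real u :: complex) = sqrt (y\<^sup>2 + u\<^sup>2)"
    by (simp add: cmod_def)
  moreover have "y\<^sup>2 + u\<^sup>2 > 0"
    using assms by (simp add: add_nonneg_pos)
  ultimately show ?thesis
    by (simp add: half_ln_sq_def ln_sqrt)
qed

lemma borel_measurable_Ln_vertical_line:
  "(\<lambda>u. Ln (of_real y + \<i> * of_real u)) \<in> borel_measurable borel"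
proof (rule borel_measurable_continuous_countable_exceptions[where X = "{0}"])
  show "continuous_on (- {0}) (\<lambda>u. Ln (of_real y + \<i> * of_real u))"
    by (intro continuous_intros) (auto simp: complex_nonpos_Reals_iff)
qed simp

lemma has_bochner_integral_Im_Ln_vertical_line:
  "has_bochner_integral lborel (\<lambda>u. sech (pi * u) * Im (Ln (of_real y + \<i> * of_real u))) 0"
proof -
  define g where "g = (\<lambda>u. Im (Ln (of_real y + \<i> * of_real u)))"
  have [measurable]: "g \<in> borel_measurable borel"
    unfolding g_def using borel_measurable_Ln_vertical_line[of y] by measurable
  have "\<bar>g u\<bar> \<le> pi" if "u \<noteq> 0" for u
  proof -
    have "of_real y + \<i> * of_real u \<noteq> (0::complex)"
      using that by (auto simp: complex_eq_iff)
    then show ?thesis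
      using mpi_less_Im_Ln Im_Ln_le_pi by (fastforce simp: g_def abs_le_iff)
  qed
  then have "AE u in lborel. norm (sech (pi * u) * g u) \<le> norm (sech (pi * u) * pi)"
    using AE_lborel_singleton[of 0] by (auto simp: abs_mult sech_pos less_imp_le)
  moreover have "integrable lborel (\<lambda>u. sech (pi * u) * pi)"
    using has_bochner_integral_sech_pi by (auto simp: has_bochner_integral_iff)
  ultimately have int: "integrable lborel (\<lambda>u. sech (pi * u) * g u)"
    by (rule Bochner_Integration.integrable_bound[rotated 2]) measurable
  have odd: "g (- u) = - g u" if "u \<noteq> 0" for u
  proof -
    have "of_real y + \<i> * of_real u \<notin> \<real>\<^sub>\<le>\<^sub>0"
      using that by (auto simp: complex_nonpos_Reals_iff)
    from arg_cong[OF cnj_Ln[OF this], of Im] show ?thesis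
      by (simp add: g_def)
  qed
  have "(\<integral>u. sech (pi * u) * g u \<partial>lborel) = (\<integral>u. sech (pi * (- u)) * g (- u) \<partial>lborel)"
    using lborel_integral_real_affine[of "-1" "\<lambda>u. sech (pi * u) * g u" 0] by simp
  also have "\<dots> = (\<integral>u. - (sech (pi * u) * g u) \<partial>lborel)"
  proof (rule integral_cong_AE)
    show "AE u in lborel. sech (pi * (- u)) * g (- u) = - (sech (pi * u) * g u)"
      using AE_lborel_singleton[of 0] by eventually_elim (simp add: odd sech_minus)
  qed measurable
  also have "\<dots> = - (\<integral>u. sech (pi * u) * g u \<partial>lborel)"
    by simp
  finally show ?thesis
    using int by (simp add: has_bochner_integral_iff g_def)
qed

section \<open>The expectation of the logarithm\<close>

theorem mainTheorem3:
  fixes M :: "'a measure" and L\<^sub>E :: "'a \<Rightarrow> real" and x :: real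
  assumes "prob_space M"
    and "distributed M lborel L\<^sub>E (\<lambda>u. ennreal (sech (pi * u)))"
  shows "integrable M (\<lambda>\<omega>. Ln (euler_umbra_arg L\<^sub>E x \<omega>)) \<and>
    euler_umbra_fun M L\<^sub>E Ln x =
      Ln (complex_of_real
        (2 * ((Gamma (3/4 + 1/2 * \<bar>x - 1/2\<bar>))\<^sup>2 / (Gamma (1/4 + 1/2 * \<bar>x - 1/2\<bar>))\<^sup>2)))"
proof -
  define h where "h = (\<lambda>u. Ln (complex_of_real (x - 1/2) + \<i> * complex_of_real u))"
  define V where "V = 2 * ((Gamma (3/4 + 1/2 * \<bar>x - 1/2\<bar>))\<^sup>2 / (Gamma (1/4 + 1/2 * \<bar>x - 1/2\<bar>))\<^sup>2)"
  have [measurable]: "h \<in> borel_measurable borel"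
    unfolding h_def by (rule borel_measurable_Ln_vertical_line)
  have push: "has_bochner_integral M (\<lambda>\<omega>. g (L\<^sub>E \<omega>)) v"
    if "has_bochner_integral lborel (\<lambda>u. sech (pi * u) * g u) v" "g \<in> borel_measurable borel"
    for g :: "real \<Rightarrow> real" and v
    using that distributed_integrable[OF assms(2), of g] distributed_integral[OF assms(2), of g]
    by (simp add: has_bochner_integral_iff sech_pos less_imp_le)
  have "has_bochner_integral lborel (\<lambda>u. sech (pi * u) * half_ln_sq \<bar>x - 1/2\<bar> u) (ln V)"
    unfolding has_bochner_integral_iff V_def
    using integrable_half_ln_sq[of "\<bar>x - 1/2\<bar>"] integral_half_ln_sq[of "\<bar>x - 1/2\<bar>"] by simp
  also have "?this \<longleftrightarrow> has_bochner_integral lborel (\<lambda>u. sech (pi * u) * Re (h u)) (ln V)"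
  proof (rule has_bochner_integral_cong_AE)
    show "AE u in lborel. sech (pi * u) * half_ln_sq \<bar>x - 1/2\<bar> u = sech (pi * u) * Re (h u)"
      using AE_lborel_singleton[of 0]
      by eventually_elim (unfold h_def, subst Re_Ln_vertical_line, auto)
  qed measurable
  finally have re: "has_bochner_integral M (\<lambda>\<omega>. Re (h (L\<^sub>E \<omega>))) (ln V)"
    by (rule push) measurable
  have "has_bochner_integral lborel (\<lambda>u. sech (pi * u) * Im (h u)) 0"
    unfolding h_def by (rule has_bochner_integral_Im_Ln_vertical_line)
  then have im: "has_bochner_integral M (\<lambda>\<omega>. Im (h (L\<^sub>E \<omega>))) 0"
    by (rule push) measurable
  have "has_bochner_integral M
      (\<lambda>\<omega>. complex_of_real (Re (h (L\<^sub>E \<omega>))) + \<i> * complex_of_real (Im (h (L\<^sub>E \<omega>))))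
      (complex_of_real (ln V) + \<i> * complex_of_real 0)"
    by (intro has_bochner_integral_add has_bochner_integral_mult_right
        has_bochner_integral_of_real re im)
  then have "has_bochner_integral M (\<lambda>\<omega>. Ln (euler_umbra_arg L\<^sub>E x \<omega>)) (complex_of_real (ln V))"
    by (simp add: complex_eq[symmetric] h_def euler_umbra_arg_def)
  moreover have "V > 0"
    unfolding V_def by (intro mult_pos_pos divide_pos_pos zero_less_power Gamma_real_pos
        add_pos_nonneg) auto
  ultimately show ?thesis
    unfolding V_def[symmetric]
    by (simp add: has_bochner_integral_iff euler_umbra_fun_def Ln_of_real)
qed

end
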